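(* Every second countable compact $T_1$ space has a graded $\omega$-band-basis.
   Context: Let $(\mathbb{P},\leq)$ be a poset. A band of $\mathbb{P}$ is a finite subset $F\subseteq\mathbb{P}$ such that every $p\in\mathbb{P}$ is comparable to some $f\in F$ (i.e. $p\leq f$ or $f\leq p$). $\mathbb{P}$ is an $\omega$-poset if every principal filter $p^\leq=\{q\in\mathbb{P}:p\leq q\}$ is finite and, for each $n\in\omega$, the number of principal filters of size $n$ is finite. In an $\omega$-poset the rank of $p$ is the (finite) number $\mathsf{r}(p)=\sup_{q>p}(\mathsf{r}(q)+1)$, so maximal elements have rank $0$. An $\omega$-poset $\mathbb{P}$ is graded if the rank function maps intervals onto intervals, i.e. whenever $p<q$, the set $\{\mathsf{r}(s):p<s<q\}$ equals $\{n\in\omega:\mathsf{r}(q)<n<\mathsf{r}(p)\}$; equivalently, $\mathsf{r}(p)=\mathsf{r}(q)+1$ whenever $p<q$ and there is no $s$ with $p<s<q$. A basis $\mathbb{P}$ of a topological space $X$, ordered by inclusion, is a band-basis if, for all finite $F\subseteq\mathbb{P}$, $F$ is a band of $\mathbb{P}$ if and only if $X=\bigcup F$. It is an $\omega$-band-basis if it is a band-basis and also an $\omega$-poset with respect to inclusion; it is graded if it is graded as a poset. *)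

theory Defs
  imports "HOL-Analysis.Analysis"
begin

(* A poset is given as a subset P of a type of class order, with the induced order.  For families
   of sets the class order is inclusion. *)

definition is_band :: "'p::order set \<Rightarrow> 'p set \<Rightarrow> bool" where
  "is_band P F \<longleftrightarrow> finite F \<and> F \<subseteq> P \<and> (\<forall>p\<in>P. \<exists>f\<in>F. p \<le> f \<or> f \<le> p)"

definition principal_filter :: "'p::order set \<Rightarrow> 'p \<Rightarrow> 'p set" where
  "principal_filter P p = {q\<in>P. p \<le> q}"

definition omega_poset :: "'p::order set \<Rightarrow> bool" where
  "omega_poset P \<longleftrightarrow>
     (\<forall>p\<in>P. finite (principal_filter P p)) \<and>
     (\<forall>n. finite {U \<in> principal_filter P ` P. card U = n})"

(* The finiteness guard only makes the recursion terminate for arbitrary P; it always holds in an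
   omega-poset (see poset_rank_eq).  The supremum is taken in nat, where the empty supremum is 0. *)
function poset_rank :: "'p::order set \<Rightarrow> 'p \<Rightarrow> nat" where
  "poset_rank P p = (if finite {q\<in>P. p < q} then (SUP q\<in>{q\<in>P. p < q}. poset_rank P q + 1) else 0)"
  by pat_completeness auto
termination
proof (relation "Wellfounded.measure (\<lambda>(P, p). card {q\<in>P. p < q})", goal_cases)
  case 1
  show ?case by simp
next
  case (2 P p q)
  then have "{r\<in>P. q < r} \<subset> {r\<in>P. p < r}" by auto
  with 2 show ?case by (simp add: psubset_card_mono)
qed

declare poset_rank.simps [simp del]

lemma poset_rank_eq:
  assumes "omega_poset P" "p \<in> P"
  shows "poset_rank P p = (SUP q\<in>{q\<in>P. p < q}. poset_rank P q + 1)"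
proof -
  have "finite {q\<in>P. p < q}"
    using assms unfolding omega_poset_def principal_filter_def
    by (auto elim!: finite_subset[rotated] dest!: bspec)
  then show ?thesis by (subst poset_rank.simps) simp
qed

definition graded :: "'p::order set \<Rightarrow> bool" where
  "graded P \<longleftrightarrow>
     (\<forall>p\<in>P. \<forall>q\<in>P. p < q \<longrightarrow>
        poset_rank P ` {s\<in>P. p < s \<and> s < q} = {n. poset_rank P q < n \<and> n < poset_rank P p})"

definition basis_of :: "'a topology \<Rightarrow> 'a set set \<Rightarrow> bool" where
  "basis_of X P \<longleftrightarrow> openin X = arbitrary union_of (\<lambda>U. U \<in> P)"

definition band_basis :: "'a topology \<Rightarrow> 'a set set \<Rightarrow> bool" where
  "band_basis X P \<longleftrightarrow>
     basis_of X P \<and> (\<forall>F. finite F \<and> F \<subseteq> P \<longrightarrow> (is_band P F \<longleftrightarrow> topspace X = \<Union>F))"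

definition omega_band_basis :: "'a topology \<Rightarrow> 'a set set \<Rightarrow> bool" where
  "omega_band_basis X P \<longleftrightarrow> band_basis X P \<and> omega_poset P"

end

theory Submission
  imports Defs
begin

text \<open>
  The basis is the union of a sequence of finite open covers \<open>L 0, L 1, \<dots>\<close>, each of whose members
  \<open>p\<close> carries a distinguished point \<open>x \<in> p\<close>.  The point is a witness for comparability: every
  member of the basis that contains \<open>x\<close> is comparable to \<open>p\<close>.  A cover by basis elements must
  catch \<open>x\<close>, so it has an element comparable to \<open>p\<close>; hence covers are bands.  The converse holds
  for every basis of nonempty sets in a \<open>T\<^sub>1\<close> space, because a point missed by a finite family
  has a neighbourhood that includes no member of the family.

  A new cover is built from a finite family \<open>\<F>\<close> of open sets, which contains all earlier sets, a
  cover to be refined, and some sets that separate the earlier distinguished points.  Let \<open>N(z)\<close> be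
  the intersection of the members of \<open>\<F>\<close> that contain \<open>z\<close>.  There are only finitely many sets
  \<open>N(z)\<close>; choose a representative point for each of them, and remove from each \<open>N(z)\<close> the
  representatives of the others, which leaves an open set because the space is \<open>T\<^sub>1\<close>.  The
  resulting sets form an antichain, each with its representative as a private point, and still
  every member of \<open>\<F>\<close> is a union of them (\<open>pointed_refinement\<close>).

  The last property yields the grading.  If \<open>p\<close> is a set of level \<open>m\<close> with point \<open>x\<close> and is
  included in \<open>q\<close> of level \<open>k\<close>, and if \<open>k < n < m\<close>, then \<open>q\<close> is a union of sets of level \<open>n\<close>, so
  one of these, \<open>s\<close> say, satisfies \<open>x \<in> s \<subseteq> q\<close>; and \<open>x \<in> s\<close> already forces \<open>p \<subseteq> s\<close>.  The
  separating sets ensure that a set is never repeated in a later level unless it is a singleton.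
  As nothing lies strictly below a singleton, repeated singletons do not disturb the ranks, and
  the rank of a set is the first level in which it occurs.
\<close>

section \<open>Posets with a level function\<close>

text \<open>The level function must be the rank: by \<open>parent\<close> there is a chain of \<open>lev p\<close> elements
  above \<open>p\<close>, and by \<open>decreasing\<close> no chain is longer.  The same chain bounds the size of the
  principal filter of \<open>p\<close> from below, so that only finitely many levels have filters of a given
  size.\<close>

locale levelled_poset =
  fixes P :: "'p::order set" and lev :: "'p \<Rightarrow> nat"
  assumes decreasing: "\<lbrakk>p \<in> P; q \<in> P; p < q\<rbrakk> \<Longrightarrow> lev q < lev p"
    and parent: "\<lbrakk>p \<in> P; lev p = Suc n\<rbrakk> \<Longrightarrow> \<exists>q\<in>P. p < q \<and> lev q = n"
    and between: "\<lbrakk>p \<in> P; q \<in> P; p < q; lev q < n; n < lev p\<rbrakk>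
                    \<Longrightarrow> \<exists>s\<in>P. p < s \<and> s < q \<and> lev s = n"
    and finite_level: "finite {p\<in>P. lev p = n}"
begin

lemma finite_levels_below: "finite {p\<in>P. lev p \<le> n}"
proof -
  have "{p\<in>P. lev p \<le> n} = (\<Union>k\<le>n. {p\<in>P. lev p = k})" by auto
  then show ?thesis using finite_level by simp
qed

lemma finite_principal_filter:
  assumes "p \<in> P" shows "finite (principal_filter P p)"
proof (rule finite_subset[OF _ finite_levels_below[of "lev p"]])
  show "principal_filter P p \<subseteq> {q\<in>P. lev q \<le> lev p}"
    using decreasing[OF assms] unfolding principal_filter_def by (fastforce simp: le_less)
qed

lemma ancestor_in_every_level:
  assumes "p \<in> P" "k \<le> lev p"
  shows "\<exists>q\<in>P. p \<le> q \<and> lev q = k"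
  using assms
proof (induction "lev p - k" arbitrary: p)
  case 0
  then show ?case by auto
next
  case (Suc d)
  have "lev p = Suc (lev p - 1)" using Suc.hyps(2) by linarith
  from parent[OF Suc.prems(1) this]
  obtain q where q: "q \<in> P" "p < q" "lev q = lev p - 1" by blast
  have "d = lev q - k" "k \<le> lev q" using Suc.hyps(2) q(3) by linarith+
  then obtain r where "r \<in> P" "q \<le> r" "lev r = k" using Suc.hyps(1) q(1) by blast
  moreover from this q have "p \<le> r" by simp
  ultimately show ?case by blast
qed

lemma level_less_card_principal_filter:
  assumes "p \<in> P" shows "lev p < card (principal_filter P p)"
proof -
  have "{..lev p} \<subseteq> lev ` principal_filter P p"
  proof
    fix k assume "k \<in> {..lev p}"
    then have "k \<le> lev p" by simp
    from ancestor_in_every_level[OF assms this]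
    show "k \<in> lev ` principal_filter P p" unfolding principal_filter_def by blast
  qed
  then have "card {..lev p} \<le> card (principal_filter P p)"
    by (rule surj_card_le[OF finite_principal_filter[OF assms]])
  then show ?thesis by simp
qed

lemma omega: "omega_poset P"
  unfolding omega_poset_def
proof (intro conjI ballI allI)
  fix n
  have "{U \<in> principal_filter P ` P. card U = n} \<subseteq> principal_filter P ` {p\<in>P. lev p \<le> n}"
  proof
    fix U assume "U \<in> {U \<in> principal_filter P ` P. card U = n}"
    then obtain p where p: "p \<in> P" "U = principal_filter P p" "card U = n" by blast
    with level_less_card_principal_filter[OF p(1)] have "lev p \<le> n" by simp
    with p show "U \<in> principal_filter P ` {p\<in>P. lev p \<le> n}" by blast
  qed
  then show "finite {U \<in> principal_filter P ` P. card U = n}"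
    by (rule finite_subset) (intro finite_imageI finite_levels_below)
qed (rule finite_principal_filter)

lemma rank_eq_level: "p \<in> P \<Longrightarrow> poset_rank P p = lev p"
proof (induction "lev p" arbitrary: p rule: less_induct)
  case less
  have "poset_rank P p = (SUP q\<in>{q\<in>P. p < q}. poset_rank P q + 1)"
    by (rule poset_rank_eq[OF omega less.prems])
  also have "\<dots> = (SUP q\<in>{q\<in>P. p < q}. lev q + 1)"
    using less decreasing by (intro arg_cong[where f = Sup] image_cong) auto
  also have "\<dots> = lev p"
  proof (cases "lev p")
    case 0
    then have "{q\<in>P. p < q} = {}" using decreasing[OF less.prems] by auto
    then show ?thesis using 0 by (simp add: Sup_nat_def)
  next
    case (Suc n)
    then obtain q where q: "q \<in> P" "p < q" "lev q = n" using parent[OF less.prems] by blast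
    show ?thesis
    proof (rule cSup_eq_maximum)
      show "lev p \<in> (\<lambda>q. lev q + 1) ` {q\<in>P. p < q}" using q Suc by force
      show "k \<le> lev p" if "k \<in> (\<lambda>q. lev q + 1) ` {q\<in>P. p < q}" for k
        using that decreasing[OF less.prems] by (auto simp: Suc_le_eq)
    qed
  qed
  finally show ?case .
qed

lemma graded: "graded P"
  unfolding graded_def
proof (intro ballI impI)
  fix p q assume pq: "p \<in> P" "q \<in> P" "p < q"
  have "poset_rank P ` {s\<in>P. p < s \<and> s < q} = lev ` {s\<in>P. p < s \<and> s < q}"
    by (rule image_cong) (auto simp: rank_eq_level)
  also have "\<dots> = {n. lev q < n \<and> n < lev p}"
  proof (intro set_eqI iffI)
    fix n assume "n \<in> lev ` {s\<in>P. p < s \<and> s < q}"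
    then show "n \<in> {n. lev q < n \<and> n < lev p}" using decreasing pq by blast
  next
    fix n assume "n \<in> {n. lev q < n \<and> n < lev p}"
    then show "n \<in> lev ` {s\<in>P. p < s \<and> s < q}" using between[OF pq] by blast
  qed
  finally show "poset_rank P ` {s\<in>P. p < s \<and> s < q}
      = {n. poset_rank P q < n \<and> n < poset_rank P p}"
    using pq by (simp add: rank_eq_level)
qed

end

section \<open>Bands and covers\<close>

text \<open>If a finite family of nonempty sets misses \<open>x\<close>, then removing one point of each member
  leaves a neighbourhood of \<open>x\<close> that includes no member.  A basis element inside it around \<open>x\<close> is
  incomparable to the whole family.\<close>

lemma band_imp_cover:
  assumes t1: "t1_space X" and basis: "basis_of X P" and ne: "{} \<notin> P" and band: "is_band P F"
  shows "topspace X = \<Union>F"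
proof (rule ccontr)
  assume neq: "topspace X \<noteq> \<Union>F"
  have F: "finite F" "F \<subseteq> P" using band by (auto simp: is_band_def)
  have "openin X f" if "f \<in> F" for f
    using that F basis unfolding basis_of_def openin_topology_base_unique by blast
  then have "\<Union>F \<subseteq> topspace X" using openin_subset by blast
  with neq obtain x where x: "x \<in> topspace X" "x \<notin> \<Union>F" by blast
  obtain z where z: "\<And>f. f \<in> F \<Longrightarrow> z f \<in> f" using F ne by (metis ex_in_conv subsetD)
  have "finite (z ` F) \<and> z ` F \<subseteq> topspace X" using F z \<open>\<Union>F \<subseteq> topspace X\<close> by blast
  then have "closedin X (z ` F)" using t1[unfolded t1_space_closedin_finite] by blast
  then have "openin X (topspace X - z ` F)" by (simp add: openin_diff)
  moreover have "x \<in> topspace X - z ` F" using x z by auto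
  ultimately obtain p where p: "p \<in> P" "x \<in> p" "p \<subseteq> topspace X - z ` F"
    using basis unfolding basis_of_def openin_topology_base_unique by meson
  then obtain f where "f \<in> F" "p \<subseteq> f \<or> f \<subseteq> p" using band by (auto simp: is_band_def)
  then show False using p x z by blast
qed

text \<open>A point of \<open>p\<close> around which all basis elements are comparable to \<open>p\<close> forces every cover to
  contain an element comparable to \<open>p\<close>.\<close>

lemma band_basis_if_witness:
  assumes t1: "t1_space X" and basis: "basis_of X P"
    and witness: "\<And>p. p \<in> P \<Longrightarrow> \<exists>x\<in>p. \<forall>q\<in>P. x \<in> q \<longrightarrow> p \<subseteq> q \<or> q \<subseteq> p"
  shows "band_basis X P"
  unfolding band_basis_def
proof (intro conjI allI impI basis)
  fix F assume F: "finite F \<and> F \<subseteq> P"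
  show "is_band P F \<longleftrightarrow> topspace X = \<Union>F"
  proof
    assume "is_band P F"
    then show "topspace X = \<Union>F" using band_imp_cover[OF t1 basis] witness by blast
  next
    assume cover: "topspace X = \<Union>F"
    have "\<exists>f\<in>F. p \<subseteq> f \<or> f \<subseteq> p" if "p \<in> P" for p
    proof -
      obtain x where x: "x \<in> p" "\<forall>q\<in>P. x \<in> q \<longrightarrow> p \<subseteq> q \<or> q \<subseteq> p" using witness \<open>p \<in> P\<close> by blast
      have "openin X p"
        using that basis unfolding basis_of_def openin_topology_base_unique by blast
      then have "p \<subseteq> \<Union>F" using cover openin_subset by metis
      then obtain f where "f \<in> F" "x \<in> f" using x(1) by blast
      then show ?thesis using x(2) F by blast
    qed
    then show "is_band P F" using F by (simp add: is_band_def)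
  qed
qed

section \<open>Sequences of pointed covers\<close>

text \<open>A member \<open>(p, x)\<close> of level \<open>n\<close> is an open set with its distinguished point.  The conditions
  \<open>private_point\<close>, \<open>later_subset\<close> and \<open>later_small\<close> treat the sets of the same, an earlier and a
  later level around a distinguished point, and together make that point a witness for
  comparability.  The strictness in \<open>later_small\<close> lets only singletons occur in two levels; these
  must be permitted to recur, because an isolated point has no smaller neighbourhood.\<close>

locale pointed_cover_sequence =
  fixes X :: "'a topology" and L :: "nat \<Rightarrow> ('a set \<times> 'a) set"
  assumes t1: "t1_space X"
    and finite_L: "finite (L n)"
    and open_L: "(p, x) \<in> L n \<Longrightarrow> openin X p"
    and point_in: "(p, x) \<in> L n \<Longrightarrow> x \<in> p"
    and private_point: "\<lbrakk>(p, x) \<in> L n; (q, y) \<in> L n; x \<in> q\<rbrakk> \<Longrightarrow> p = q"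
    and later_subset: "\<lbrakk>(q, y) \<in> L m; (p, x) \<in> L n; m < n; x \<in> q\<rbrakk> \<Longrightarrow> p \<subseteq> q"
    and later_small: "\<lbrakk>(q, y) \<in> L m; (p, x) \<in> L n; m < n; y \<in> p\<rbrakk> \<Longrightarrow> p \<subset> q \<or> p = q \<and> q = {y}"
    and union_of_later: "\<lbrakk>(q, y) \<in> L m; m < n; z \<in> q\<rbrakk> \<Longrightarrow> \<exists>(p, x)\<in>L n. z \<in> p \<and> p \<subseteq> q"
    and cover: "z \<in> topspace X \<Longrightarrow> \<exists>(p, x)\<in>L n. z \<in> p"
    and fine: "\<lbrakk>openin X U; z \<in> U\<rbrakk> \<Longrightarrow> \<exists>n. \<forall>(p, x)\<in>L n. z \<in> p \<longrightarrow> p \<subseteq> U"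
begin

definition sets :: "'a set set" where
  "sets = (\<Union>n. fst ` L n)"

definition first_level :: "'a set \<Rightarrow> nat" where
  "first_level p = (LEAST n. p \<in> fst ` L n)"

lemma in_sets: "(p, x) \<in> L n \<Longrightarrow> p \<in> sets"
  unfolding sets_def by force

lemma in_first_level:
  assumes "p \<in> sets" obtains x where "(p, x) \<in> L (first_level p)"
proof -
  have "\<exists>n. p \<in> fst ` L n" using assms by (auto simp: sets_def)
  then have "p \<in> fst ` L (first_level p)" unfolding first_level_def by (rule LeastI_ex)
  then show ?thesis using that by auto
qed

lemma first_level_le: "(p, x) \<in> L n \<Longrightarrow> first_level p \<le> n"
  unfolding first_level_def by (rule Least_le) force

lemma included_in_later:
  assumes "(q, y) \<in> L m" "(p, x) \<in> L n" "m < n" "q \<subseteq> p"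
  shows "p = q \<and> q = {y}"
  using later_small[OF assms(1-3)] point_in[OF assms(1)] assms(4) by blast

lemma comparable_if_point_in:
  assumes "(p, x) \<in> L m" "(q, y) \<in> L n" "x \<in> q"
  shows "p \<subseteq> q \<or> q \<subseteq> p"
proof (cases m n rule: linorder_cases)
  case less
  then show ?thesis using later_small[OF assms(1,2) _ assms(3)] by blast
next
  case equal
  then show ?thesis using private_point[of p x n q y] assms by blast
next
  case greater
  then show ?thesis using later_subset[OF assms(2,1) _ assms(3)] by blast
qed

text \<open>A set that has a nonempty proper subset is not a singleton, hence occurs in one level only.\<close>

lemma first_level_eq:
  assumes s: "(s, y) \<in> L n" and p: "p \<in> sets" "p \<subset> s"
  shows "first_level s = n"
proof (rule ccontr)
  assume "first_level s \<noteq> n"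
  then have "first_level s < n" using first_level_le[OF s] by simp
  moreover obtain y' where "(s, y') \<in> L (first_level s)"
    using in_first_level[OF in_sets[OF s]] by blast
  ultimately have "s = {y'}" using included_in_later[of s y' _ s y n] s by blast
  moreover obtain x where "(p, x) \<in> L (first_level p)" using in_first_level[OF p(1)] by blast
  then have "p \<noteq> {}" using point_in by blast
  ultimately show False using p by blast
qed

text \<open>The source of the intermediate elements that a grading needs: a set of an earlier level lies
  above \<open>p\<close> as soon as it contains the one point \<open>x\<close>, and it occurs in no other level because
  \<open>p\<close> is a nonempty proper subset.\<close>

lemma above_in_level:
  assumes p: "(p, x) \<in> L (first_level p)" and n: "n < first_level p"
    and s: "(s, y) \<in> L n" "x \<in> s"
  shows "p \<subset> s \<and> first_level s = n"
proof -
  have "p \<subseteq> s" using later_subset[OF s(1) p n s(2)] .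
  moreover have "p \<noteq> s" using first_level_le[OF s(1)] n by auto
  ultimately show ?thesis using first_level_eq[OF s(1)] in_sets[OF p] by blast
qed

lemma levelled: "levelled_poset sets first_level"
proof
  fix p q assume p: "p \<in> sets" and q: "q \<in> sets" and "p < q"
  obtain x where x: "(p, x) \<in> L (first_level p)" using in_first_level[OF p] by blast
  obtain y where y: "(q, y) \<in> L (first_level q)" using in_first_level[OF q] by blast
  show less: "first_level q < first_level p"
  proof (rule ccontr)
    assume "\<not> first_level q < first_level p"
    then consider "first_level p = first_level q" | "first_level p < first_level q" by linarith
    then show False
    proof cases
      case 1
      then have "p = q" using private_point[of p x _ q y] x y point_in[OF x] \<open>p < q\<close> by auto
      with \<open>p < q\<close> show False by simp
    next
      case 2
      then have "q = p" using included_in_later[OF x y] \<open>p < q\<close> by simp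
      with \<open>p < q\<close> show False by simp
    qed
  qed
  fix n assume n: "first_level q < n" "n < first_level p"
  have "x \<in> q" using point_in[OF x] \<open>p < q\<close> by auto
  then obtain s z where s: "(s, z) \<in> L n" "x \<in> s" "s \<subseteq> q" using union_of_later[OF y n(1)] by blast
  have "p \<subset> s" "first_level s = n" using above_in_level[OF x n(2) s(1,2)] by auto
  moreover have "s \<noteq> q" using n \<open>first_level s = n\<close> by auto
  ultimately show "\<exists>s\<in>sets. p < s \<and> s < q \<and> first_level s = n"
    using s(3) in_sets[OF s(1)] by blast
next
  fix p n assume p: "p \<in> sets" and n: "first_level p = Suc n"
  obtain x where x: "(p, x) \<in> L (first_level p)" using in_first_level[OF p] by blast
  have "x \<in> topspace X" using openin_subset[OF open_L[OF x]] point_in[OF x] by blast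
  then obtain s z where s: "(s, z) \<in> L n" "x \<in> s" using cover by blast
  then show "\<exists>q\<in>sets. p < q \<and> first_level q = n"
    using above_in_level[OF x _ s] n in_sets[OF s(1)] by auto
next
  fix n
  have "{p \<in> sets. first_level p = n} \<subseteq> fst ` L n" 
  proof
    fix p assume "p \<in> {p \<in> sets. first_level p = n}"
    then obtain x where "(p, x) \<in> L n" by (auto elim: in_first_level)
    then show "p \<in> fst ` L n" by force
  qed
  then show "finite {p \<in> sets. first_level p = n}" by (rule finite_subset) (intro finite_imageI finite_L)
qed

lemma basis: "basis_of X sets"
  unfolding basis_of_def openin_topology_base_unique
proof (intro conjI allI impI)
  show "openin X p" if "p \<in> sets" for p using in_first_level[OF that] open_L by metis
  fix U z assume "openin X U \<and> z \<in> U"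
  then have U: "openin X U" and z: "z \<in> U" by auto
  obtain n where n: "\<forall>(p, x)\<in>L n. z \<in> p \<longrightarrow> p \<subseteq> U" using fine[OF U z] by blast
  have "z \<in> topspace X" using z openin_subset[OF U] by blast
  then obtain p x where "(p, x) \<in> L n" "z \<in> p" using cover by blast
  then show "\<exists>p. p \<in> sets \<and> z \<in> p \<and> p \<subseteq> U" using n in_sets by blast
qed

lemma graded_omega_band_basis: "omega_band_basis X sets \<and> graded sets"
proof -
  have "\<exists>x\<in>p. \<forall>q\<in>sets. x \<in> q \<longrightarrow> p \<subseteq> q \<or> q \<subseteq> p" if p: "p \<in> sets" for p
  proof -
    obtain x where x: "(p, x) \<in> L (first_level p)" using in_first_level[OF p] by blast
    have "p \<subseteq> q \<or> q \<subseteq> p" if q: "q \<in> sets" "x \<in> q" for q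
      using in_first_level[OF q(1)] comparable_if_point_in[OF x _ q(2)] by metis
    then show ?thesis using point_in[OF x] by blast
  qed
  then have "band_basis X sets" using band_basis_if_witness[OF t1 basis] by blast
  then show ?thesis
    using levelled levelled_poset.omega levelled_poset.graded
    unfolding omega_band_basis_def by blast
qed

end

section \<open>Refining a finite open family\<close>

definition pointed_open :: "'a topology \<Rightarrow> ('a set \<times> 'a) set \<Rightarrow> bool" where
  "pointed_open X L \<longleftrightarrow> finite L \<and> (\<forall>(p, x)\<in>L. openin X p \<and> x \<in> p)"

text \<open>With \<open>N(z)\<close> the intersection of all members of \<open>\<F>\<close> that contain \<open>z\<close>, and with a set \<open>Y\<close>
  that contains one point \<open>y\<close> for each value \<open>N(y)\<close>, the family consists of the pairs of
  \<open>N(y) - (Y - {y})\<close> and \<open>y\<close>.  An arbitrary point \<open>z\<close> lies in the set that belongs to the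
  representative \<open>y\<close> of \<open>N(z)\<close>: it is not another representative \<open>y'\<close>, because then \<open>N(y')\<close> would
  be \<open>N(y)\<close>.\<close>

lemma pointed_refinement:
  assumes t1: "t1_space X" and fin: "finite \<F>" and op: "\<forall>U\<in>\<F>. openin X U"
  shows "\<exists>L. pointed_open X L
    \<and> (\<forall>(p, y)\<in>L. \<forall>U\<in>\<F>. y \<in> U \<longrightarrow> p \<subseteq> U)
    \<and> (\<forall>(p, y)\<in>L. \<forall>(p', y')\<in>L. y \<in> p' \<longrightarrow> p = p')
    \<and> (\<forall>z\<in>topspace X. \<exists>(p, y)\<in>L. z \<in> p \<and> (\<forall>U\<in>\<F>. z \<in> U \<longrightarrow> p \<subseteq> U))"
proof -
  define N where "N z = topspace X \<inter> \<Inter>{U\<in>\<F>. z \<in> U}" for z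
  have N_sub: "N z \<subseteq> U" if "U \<in> \<F>" "z \<in> U" for z U using that unfolding N_def by blast
  have N_self: "z \<in> N z" if "z \<in> topspace X" for z using that unfolding N_def by blast
  have N_open: "openin X (N z)" for z
  proof (cases "{U\<in>\<F>. z \<in> U} = {}")
    case True
    then show ?thesis unfolding N_def True by simp
  next
    case False
    then have "openin X (\<Inter>{U\<in>\<F>. z \<in> U})" using fin op by (intro openin_Inter) auto
    then show ?thesis unfolding N_def by blast
  qed
  have "N ` topspace X \<subseteq> (\<lambda>\<G>. topspace X \<inter> \<Inter>\<G>) ` Pow \<F>" unfolding N_def by blast
  then have "finite (N ` topspace X)" by (rule finite_subset) (simp add: fin)
  then obtain Y where Y: "Y \<subseteq> topspace X" "finite Y" "inj_on N Y" "N ` Y = N ` topspace X"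
    by (metis finite_imageD subset_image_inj subset_refl)
  define S where "S y = N y - (Y - {y})" for y
  have S_open: "openin X (S y)" for y
  proof -
    have "finite (Y - {y}) \<and> Y - {y} \<subseteq> topspace X" using Y by blast
    then have "closedin X (Y - {y})" using t1[unfolded t1_space_closedin_finite] by blast
    then show ?thesis unfolding S_def using N_open by (rule openin_diff[rotated])
  qed
  have S_sub: "S y \<subseteq> U" if "U \<in> \<F>" "y \<in> U" for y U
    using N_sub[OF that] unfolding S_def by blast
  have S_self: "y \<in> S y" if "y \<in> Y" for y
    using that Y(1) N_self unfolding S_def by blast
  have S_private: "y = y'" if "y \<in> Y" "y \<in> S y'" for y y'
    using that unfolding S_def by blast
  have S_cover: "\<exists>y\<in>Y. z \<in> S y \<and> (\<forall>U\<in>\<F>. z \<in> U \<longrightarrow> S y \<subseteq> U)" if z: "z \<in> topspace X" for z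
  proof -
    obtain y where y: "y \<in> Y" "N y = N z" using Y(4) z by (metis image_iff)
    then have "z \<notin> Y - {y}" using Y(3) by (auto dest: inj_onD)
    then have "z \<in> S y" using N_self[OF z] y unfolding S_def by simp
    moreover have "S y \<subseteq> U" if "U \<in> \<F>" "z \<in> U" for U
      using N_sub[OF that] y unfolding S_def by blast
    ultimately show ?thesis using y by blast
  qed
  show ?thesis
  proof (intro exI[of _ "(\<lambda>y. (S y, y)) ` Y"] conjI)
    show "pointed_open X ((\<lambda>y. (S y, y)) ` Y)"
      unfolding pointed_open_def using Y(2) S_open S_self by simp
  qed (use S_sub S_private S_cover in \<open>simp; blast\<close>)+
qed

text \<open>What a level \<open>L\<close> must satisfy relative to the union \<open>Q\<close> of the earlier levels and to a cover
  \<open>E\<close> that it has to refine.\<close>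

definition next_level ::
    "'a topology \<Rightarrow> 'a set set \<Rightarrow> ('a set \<times> 'a) set \<Rightarrow> ('a set \<times> 'a) set \<Rightarrow> bool" where
  "next_level X E Q L \<longleftrightarrow> pointed_open X L
    \<and> (\<forall>(p, y)\<in>L. \<forall>(p', y')\<in>L. y \<in> p' \<longrightarrow> p = p')
    \<and> (\<forall>(q, x)\<in>Q. \<forall>(p, y)\<in>L. y \<in> q \<longrightarrow> p \<subseteq> q)
    \<and> (\<forall>(q, x)\<in>Q. \<forall>(p, y)\<in>L. x \<in> p \<longrightarrow> p \<subset> q \<or> p = q \<and> q = {x})
    \<and> (\<forall>(q, x)\<in>Q. \<forall>z\<in>q. \<exists>(p, y)\<in>L. z \<in> p \<and> p \<subseteq> q)
    \<and> (\<forall>z\<in>topspace X. \<exists>(p, y)\<in>L. z \<in> p)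
    \<and> (\<forall>(p, y)\<in>L. \<exists>U\<in>E. p \<subseteq> U)"

text \<open>Two kinds of sets are added to the family that is refined: the complement of a distinguished
  point \<open>x\<close> of \<open>Q\<close>, so that a new set contains \<open>x\<close> only if \<open>x\<close> is its own distinguished point;
  and, for \<open>(q, x)\<close> in \<open>Q\<close>, a neighbourhood \<open>W q x\<close> of \<open>x\<close> that is a proper subset of \<open>q\<close>
  unless \<open>q\<close> is a singleton, and that includes the new set with distinguished point \<open>x\<close>, if any.\<close>

lemma next_level_exists:
  assumes t1: "t1_space X" and "pointed_open X Q"
    and E: "finite E" "\<And>U. U \<in> E \<Longrightarrow> openin X U" "topspace X \<subseteq> \<Union>E"
  shows "\<exists>L. next_level X E Q L"
proof -
  have Q: "finite Q" "\<And>q x. (q, x) \<in> Q \<Longrightarrow> openin X q \<and> x \<in> q"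
    using assms(2) unfolding pointed_open_def by auto
  have "\<exists>w. openin X w \<and> x \<in> w \<and> (w \<subset> q \<or> w = q \<and> q = {x})" if qx: "(q, x) \<in> Q" for q x
  proof (cases "q = {x}")
    case True
    then show ?thesis using Q(2)[OF qx] by blast
  next
    case False
    then obtain z where z: "z \<in> q" "z \<noteq> x" using Q(2)[OF qx] by blast
    have "openin X (q - {z})"
      using Q(2)[OF qx] t1[unfolded t1_space_openin_delete_alt] by blast
    then show ?thesis using z Q(2)[OF qx] by (intro exI[of _ "q - {z}"]) auto
  qed
  then obtain W where W: "\<And>q x. (q, x) \<in> Q \<Longrightarrow>
      openin X (W q x) \<and> x \<in> W q x \<and> (W q x \<subset> q \<or> W q x = q \<and> q = {x})"
    by metis
  define \<F> where "\<F> = E \<union> fst ` Q \<union> (\<lambda>x. topspace X - {x}) ` snd ` Q \<union> (\<lambda>(q, x). W q x) ` Q"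
  have finite: "finite \<F>" unfolding \<F>_def using E Q by simp
  have "openin X (topspace X - {x})" for x
    using t1[unfolded t1_space_openin_delete_alt] by simp
  then have opens: "\<forall>U\<in>\<F>. openin X U"
    using E(2) Q(2) W unfolding \<F>_def by fastforce
  from pointed_refinement[OF t1 finite opens] obtain L where L: "pointed_open X L"
    and sub: "\<forall>(p, y)\<in>L. \<forall>U\<in>\<F>. y \<in> U \<longrightarrow> p \<subseteq> U"
    and anti: "\<forall>(p, y)\<in>L. \<forall>(p', y')\<in>L. y \<in> p' \<longrightarrow> p = p'"
    and cov: "\<forall>z\<in>topspace X. \<exists>(p, y)\<in>L. z \<in> p \<and> (\<forall>U\<in>\<F>. z \<in> U \<longrightarrow> p \<subseteq> U)"
    by (elim exE conjE)
  have sub: "p \<subseteq> U" if "(p, y) \<in> L" "U \<in> \<F>" "y \<in> U" for p y U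
    using sub that by blast
  have point_in_space: "y \<in> topspace X" if "(p, y) \<in> L" for p y
    using L that openin_subset[of X p] unfolding pointed_open_def by blast
  have in_F: "q \<in> \<F>" "topspace X - {x} \<in> \<F>" "W q x \<in> \<F>" if "(q, x) \<in> Q" for q x
    using imageI[OF that, of fst] imageI[OF that, of "\<lambda>(q, x). W q x"]
      imageI[OF imageI[OF that, of snd], of "\<lambda>x. topspace X - {x}"]
    unfolding \<F>_def by simp_all
  have new_around_old: "p \<subset> q \<or> p = q \<and> q = {x}" if q: "(q, x) \<in> Q" and p: "(p, y) \<in> L" "x \<in> p"
    for q x p y
  proof -
    have "y \<in> topspace X" by (rule point_in_space[OF p(1)])
    then have "y = x" using sub[OF p(1) in_F(2)[OF q]] p by blast
    then have "p \<subseteq> W q x" using sub[OF p(1) in_F(3)[OF q]] W[OF q] by blast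
    then show ?thesis using W[OF q] p by blast
  qed
  have unions: "\<exists>(p, y)\<in>L. z \<in> p \<and> p \<subseteq> q" if q: "(q, x) \<in> Q" and z: "z \<in> q" for q x z
  proof -
    have "z \<in> topspace X" using Q(2)[OF q] z by (meson openin_subset subsetD)
    with cov obtain p y where "(p, y) \<in> L" "z \<in> p" "\<forall>U\<in>\<F>. z \<in> U \<longrightarrow> p \<subseteq> U" by blast
    then show ?thesis using in_F(1)[OF q] z by blast
  qed
  have refines: "\<exists>U\<in>E. p \<subseteq> U" if p: "(p, y) \<in> L" for p y
  proof -
    have "y \<in> topspace X" by (rule point_in_space[OF p])
    then obtain U where "U \<in> E" "y \<in> U" using E(3) by blast
    then have "p \<subseteq> U" using sub[OF p, of U] unfolding \<F>_def by blast
    then show ?thesis using \<open>U \<in> E\<close> by blast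
  qed
  have old_around_new: "p \<subseteq> q" if "(q, x) \<in> Q" "(p, y) \<in> L" "y \<in> q" for q x p y
    using sub[OF that(2) in_F(1)[OF that(1)] that(3)] .
  show ?thesis
    unfolding next_level_def
  proof (intro exI[of _ L] conjI L anti)
    show "\<forall>(q, x)\<in>Q. \<forall>(p, y)\<in>L. y \<in> q \<longrightarrow> p \<subseteq> q"
      by (clarify, rule subsetD[OF old_around_new])
    show "\<forall>(q, x)\<in>Q. \<forall>(p, y)\<in>L. x \<in> p \<longrightarrow> p \<subset> q \<or> p = q \<and> q = {x}"
      by (intro ballI case_prodI2 impI) (auto dest: new_around_old)
    show "\<forall>(q, x)\<in>Q. \<forall>z\<in>q. \<exists>(p, y)\<in>L. z \<in> p \<and> p \<subseteq> q"
      using unions by blast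
    show "\<forall>z\<in>topspace X. \<exists>(p, y)\<in>L. z \<in> p" using cov by blast
    show "\<forall>(p, y)\<in>L. \<exists>U\<in>E. p \<subseteq> U" using refines by blast
  qed
qed

section \<open>Construction of the sequence\<close>

text \<open>The finite covers by members of a countable basis suffice: given a basis element \<open>V\<close> around
  \<open>z\<close>, the basis elements that miss \<open>z\<close> cover everything but \<open>z\<close>, so a finite cover can be chosen
  in which only \<open>V\<close> contains \<open>z\<close>.\<close>

lemma countably_many_fine_covers:
  assumes sc: "second_countable X" and comp: "compact_space X" and t1: "t1_space X"
  obtains E :: "nat \<Rightarrow> 'a set set"
  where "\<And>n. finite (E n)" and "\<And>n U. U \<in> E n \<Longrightarrow> openin X U" and "\<And>n. topspace X \<subseteq> \<Union>(E n)"
    and "\<And>U z. \<lbrakk>openin X U; z \<in> U\<rbrakk> \<Longrightarrow> \<exists>n. \<forall>V\<in>E n. z \<in> V \<longrightarrow> V \<subseteq> U"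
proof -
  obtain B where B: "countable B" "\<And>V. V \<in> B \<Longrightarrow> openin X V"
      "\<And>U x. \<lbrakk>openin X U; x \<in> U\<rbrakk> \<Longrightarrow> \<exists>V\<in>B. x \<in> V \<and> V \<subseteq> U"
    using sc unfolding second_countable_def by metis
  define C where "C = {G. finite G \<and> G \<subseteq> B \<and> topspace X \<subseteq> \<Union>G}"
  have "countable {G. finite G \<and> G \<subseteq> B}"
    using countable_Collect_finite_subset[OF B(1)] by (simp add: conj_commute)
  then have "countable C" unfolding C_def by (rule countable_subset[rotated]) auto
  have subcover: "\<exists>G\<in>C. G \<subseteq> B'" if B': "B' \<subseteq> B" "topspace X \<subseteq> \<Union>B'" for B'
  proof -
    have "\<forall>U\<in>B'. openin X U" using B' B(2) by blast
    then obtain G where "finite G" "G \<subseteq> B'" "topspace X \<subseteq> \<Union>G"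
      using comp[unfolded compact_space_alt] B'(2) by metis
    then show ?thesis using B'(1) unfolding C_def by blast
  qed
  have "topspace X \<subseteq> \<Union>B" using B(3)[OF openin_topspace] by blast
  then have "C \<noteq> {}" using subcover by blast
  have in_C: "from_nat_into C n \<in> C" for n using \<open>C \<noteq> {}\<close> by (rule from_nat_into)
  show ?thesis
  proof (rule that[of "from_nat_into C"])
    show "finite (from_nat_into C n)" "topspace X \<subseteq> \<Union>(from_nat_into C n)" for n
      using in_C[of n] unfolding C_def by auto
    show "openin X U" if "U \<in> from_nat_into C n" for n U
      using that in_C[of n] B(2) unfolding C_def by auto
    fix U z assume U: "openin X U" "z \<in> U"
    then obtain V where V: "V \<in> B" "z \<in> V" "V \<subseteq> U" using B(3) by blast
    have "topspace X \<subseteq> \<Union>(insert V {W\<in>B. z \<notin> W})"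
    proof
      fix y assume y: "y \<in> topspace X"
      show "y \<in> \<Union>(insert V {W\<in>B. z \<notin> W})"
      proof (cases "y = z")
        case True
        then show ?thesis using V by blast
      next
        case False
        have "openin X (topspace X - {z})"
          using t1[unfolded t1_space_openin_delete_alt] by simp
        then obtain W where "W \<in> B" "y \<in> W" "W \<subseteq> topspace X - {z}"
          using B(3)[of "topspace X - {z}" y] y False by blast
        then show ?thesis by blast
      qed
    qed
    then obtain G where G: "G \<in> C" "G \<subseteq> insert V {W\<in>B. z \<notin> W}"
      using subcover[of "insert V {W\<in>B. z \<notin> W}"] V by blast
    obtain n where "from_nat_into C n = G"
      using from_nat_into_surj[OF \<open>countable C\<close> G(1)] by blast
    then show "\<exists>n. \<forall>W\<in>from_nat_into C n. z \<in> W \<longrightarrow> W \<subseteq> U" using G V by blast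
  qed
qed

lemma ball_pairD: "\<lbrakk>\<forall>(a, b)\<in>A. P a b; (a, b) \<in> A\<rbrakk> \<Longrightarrow> P a b"
  by auto

lemma pointed_cover_sequence_exists:
  assumes "second_countable X" "compact_space X" and t1: "t1_space X"
  shows "\<exists>L. pointed_cover_sequence X L"
proof -
  obtain E :: "nat \<Rightarrow> 'a set set" where E: "\<And>n. finite (E n)" "\<And>n U. U \<in> E n \<Longrightarrow> openin X U"
      "\<And>n. topspace X \<subseteq> \<Union>(E n)"
    and fineE: "\<And>U z. \<lbrakk>openin X U; z \<in> U\<rbrakk> \<Longrightarrow> \<exists>n. \<forall>V\<in>E n. z \<in> V \<longrightarrow> V \<subseteq> U"
    using countably_many_fine_covers[OF assms] by metis
  define step where "step n Q = (SOME L. next_level X (E n) Q L)" for n Q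
  have step: "next_level X (E n) Q (step n Q)" if "pointed_open X Q" for n Q
    unfolding step_def by (rule someI_ex) (rule next_level_exists[OF t1 that E])
  define Q where "Q = rec_nat {} (\<lambda>n Q. Q \<union> step n Q)"
  define L where "L n = step n (Q n)" for n
  have Q_simps: "Q 0 = {}" "Q (Suc n) = Q n \<union> L n" for n by (simp_all add: Q_def L_def)
  have "pointed_open X (Q n)" for n
  proof (induction n)
    case 0
    show ?case by (simp add: Q_simps pointed_open_def)
  next
    case (Suc n)
    then have "pointed_open X (L n)" using step[of "Q n" n] unfolding L_def next_level_def by simp
    with Suc show ?case unfolding Q_simps pointed_open_def by (auto simp: ball_Un)
  qed
  then have next_level: "next_level X (E n) (Q n) (L n)" for n using step unfolding L_def by simp
  have earlier: "L m \<subseteq> Q n" if "m < n" for m n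
    using that by (induction n) (auto simp: Q_simps less_Suc_eq)
  have pointed: "finite (L n)" "\<forall>(p, x)\<in>L n. openin X p \<and> x \<in> p"
    and private_points: "\<forall>(p, y)\<in>L n. \<forall>(p', y')\<in>L n. y \<in> p' \<longrightarrow> p = p'"
    and old_around_new: "\<forall>(q, x)\<in>Q n. \<forall>(p, y)\<in>L n. y \<in> q \<longrightarrow> p \<subseteq> q"
    and new_around_old: "\<forall>(q, x)\<in>Q n. \<forall>(p, y)\<in>L n. x \<in> p \<longrightarrow> p \<subset> q \<or> p = q \<and> q = {x}"
    and unions: "\<forall>(q, x)\<in>Q n. \<forall>z\<in>q. \<exists>(p, y)\<in>L n. z \<in> p \<and> p \<subseteq> q"
    and covers: "\<forall>z\<in>topspace X. \<exists>(p, y)\<in>L n. z \<in> p"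
    and refines: "\<forall>(p, y)\<in>L n. \<exists>U\<in>E n. p \<subseteq> U" for n
    using next_level[of n] unfolding next_level_def pointed_open_def by - (elim conjE, assumption)+
  have "pointed_cover_sequence X L"
  proof
    show "t1_space X" by (rule t1)
    show "finite (L n)" for n by (rule pointed)
    show "openin X p" "x \<in> p" if "(p, x) \<in> L n" for p x n
      using pointed(2)[of n] that by auto
    show "p = q" if "(p, x) \<in> L n" "(q, y) \<in> L n" "x \<in> q" for p x n q y
      using ball_pairD[OF ball_pairD[OF private_points that(1)] that(2)] that(3) by simp
    fix q y m n assume "(q, y) \<in> L m" and "m < n"
    then have q: "(q, y) \<in> Q n" by (rule subsetD[OF earlier, rotated])
    show "p \<subseteq> q" if "(p, x) \<in> L n" "x \<in> q" for p x
      using ball_pairD[OF ball_pairD[OF old_around_new q] that(1)] that(2) by simp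
    show "p \<subset> q \<or> p = q \<and> q = {y}" if "(p, x) \<in> L n" "y \<in> p" for p x
      using ball_pairD[OF ball_pairD[OF new_around_old q] that(1)] that(2) by simp
    show "\<exists>(p, x)\<in>L n. z \<in> p \<and> p \<subseteq> q" if "z \<in> q" for z
      using bspec[OF ball_pairD[OF unions q] that] .
  next
    show "\<exists>(p, x)\<in>L n. z \<in> p" if "z \<in> topspace X" for z n
      by (rule bspec[OF covers that])
    show "\<exists>n. \<forall>(p, x)\<in>L n. z \<in> p \<longrightarrow> p \<subseteq> U" if U: "openin X U" "z \<in> U" for U z
    proof -
      obtain n where n: "\<forall>V\<in>E n. z \<in> V \<longrightarrow> V \<subseteq> U" using fineE[OF U] by blast
      have "p \<subseteq> U" if px: "(p, x) \<in> L n" and z: "z \<in> p" for p x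
      proof -
        from ball_pairD[OF refines px] obtain V where V: "V \<in> E n" "p \<subseteq> V" by (rule bexE)
        then have "V \<subseteq> U" using n z by (meson subsetD)
        with V(2) show ?thesis by (rule subset_trans)
      qed
      then show ?thesis by (intro exI[of _ n]) auto
    qed
  qed
  then show ?thesis by (rule exI[of _ L])
qed

theorem theorem1p34:
  fixes X :: "'a topology"
  assumes "second_countable X" and "compact_space X" and "t1_space X"
  shows "\<exists>P. omega_band_basis X P \<and> graded P"
  using pointed_cover_sequence_exists[OF assms] pointed_cover_sequence.graded_omega_band_basis
  by blast

end
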